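(* Let $\mathcal S_1$ be the set of matrices of the form $v\,e_ie_i^T$ with $i\in\{1,\dots,m\}$ and $v>0$, where $i$ is the index of the attacked sensor and $v$ is the variance of the single measurement attack. Suppose that the weighting parameter $\lambda>0$ satisfies, for the indices $i\in\{1,\dots,m\}$, $$\frac{e_i^TM_2e_i}{e_i^TM_1e_i}<\lambda<\frac{(e_i^TM_2e_i)^2}{(e_i^TM_1e_i)^2}.$$ Then the optimal solution to the single measurement attack problem $$\min_{\Sigma_{aa}\in\mathcal S_1}\ \lambda\big(\operatorname{tr}(M_1\Sigma_{aa})-\log|I_m+M_1\Sigma_{aa}|\big)-\operatorname{tr}(M_2\Sigma_{aa})+\log|I_m+M_2\Sigma_{aa}|$$ uniquely exists, and is specified by ($\Sigma_{aa}=v^*_{i^*}e_{i^*}e_{i^*}^T$ with) $$v_i^*=\frac{(e_i^TM_2e_i)^2-\lambda(e_i^TM_1e_i)^2}{(\lambda e_i^TM_1e_i-e_i^TM_2e_i)\,(e_i^TM_1e_i)\,(e_i^TM_2e_i)},$$ $$i^*=\operatorname*{arg\,min}_{i}\ \lambda\big(\operatorname{tr}(M_1v_i^*e_ie_i^T)-\log|I_m+M_1v_i^*e_ie_i^T|\big)-\operatorname{tr}(M_2v_i^*e_ie_i^T)+\log|I_m+M_2v_i^*e_ie_i^T|.$$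
   Context: Notation: $\mathcal S_+^m$ is the set of $m\times m$ real symmetric positive semidefinite matrices, $|\cdot|$ of a matrix is its determinant, $I_m$ is the identity matrix, $e_i$ is the $i$-th standard basis vector of $\mathbb R^m$. Setting: $A\in\mathbb R^{n\times n}$, $B\in\mathbb R^{n\times m}$, $C\in\mathbb R^{m\times n}$ with $(A,B)$ controllable and $(A,C)$ observable, observer gain $L\in\mathbb R^{n\times m}$, controller gain $K\in\mathbb R^{m\times n}$, noise covariances $\Sigma_{dd}\in\mathcal S_+^n$, $\Sigma_{nn}\in\mathcal S_+^m$. The closed-loop matrix $$\Phi=\begin{bmatrix}A&BK\\ LC&A-LC+BK\end{bmatrix}\in\mathbb R^{2n\times 2n}$$ is assumed to have spectral radius less than $1$. $\Sigma_{\xi\xi}$ is the solution of $\Sigma_{\xi\xi}=\Phi\Sigma_{\xi\xi}\Phi^T+\begin{bmatrix}\Sigma_{dd}&0\\0&L\Sigma_{nn}L^T\end{bmatrix}$, $\Sigma_{xx}$ is its upper-left $n\times n$ block, and $\Sigma_{yy}=C\Sigma_{xx}C^T+\Sigma_{nn}$; $\Sigma_{\xi\xi}$ and $\Sigma_{yy}$ are assumed invertible. Define $$M_1=\Sigma_{yy}^{-1},\qquad M_2=[\,0\ \ L^T\,]\sum_{k=0}^\infty(\Phi^T)^k\,\Sigma_{\xi\xi}^{-1}\,\Phi^k\begin{bmatrix}0\\ L\end{bmatrix}.$$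
   Formalization: Uniqueness of the optimal solution is claimed only when the arg min over i is a single index, since it fails when two sensors tie; in general, existence is proved and the optimal solutions are exactly the matrices v*_i e_i e_i^T with i in the arg min. *)

theory Defs
  imports "HOL-Analysis.Analysis"
begin

text \<open>
  A real matrix with rows indexed by \<open>'r\<close> and columns indexed by \<open>'c\<close> has type \<open>real^'c^'r\<close>.
  Block matrices are indexed by sum types, so \<open>'n + 'n\<close> stands for the index set of size \<open>2n\<close>.
  On these types \<open>*\<close> and \<open>^\<close> are entrywise; the matrix product is \<open>**\<close>.
\<close>

definition hcat :: "'a^'c^'r \<Rightarrow> 'a^'d^'r \<Rightarrow> 'a^('c::finite + 'd::finite)^'r" where
  "hcat X Y = (\<chi> i j. case j of Inl k \<Rightarrow> X $ i $ k | Inr k \<Rightarrow> Y $ i $ k)"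

definition vcat :: "'a^'c^'r \<Rightarrow> 'a^'c^'s \<Rightarrow> 'a^'c^('r::finite + 's::finite)" where
  "vcat X Y = (\<chi> i. case i of Inl k \<Rightarrow> X $ k | Inr k \<Rightarrow> Y $ k)"

definition upper_left_block :: "'a^('c::finite + 'd::finite)^('r::finite + 's::finite) \<Rightarrow> 'a^'c^'r" where
  "upper_left_block X = (\<chi> i j. X $ Inl i $ Inl j)"

primrec matpow :: "'a::semiring_1^'n^'n \<Rightarrow> nat \<Rightarrow> 'a^'n^'n" where
  "matpow X 0 = mat 1"
| "matpow X (Suc k) = X ** matpow X k"

definition psd_matrix :: "real^'n^'n \<Rightarrow> bool" where
  "psd_matrix X \<longleftrightarrow> transpose X = X \<and> (\<forall>x. 0 \<le> x \<bullet> (X *v x))"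

definition eigenvalues :: "complex^'n^'n \<Rightarrow> complex set" where
  "eigenvalues X = {l. \<exists>x. x \<noteq> 0 \<and> X *v x = l *s x}"

definition spectral_radius :: "real^'n^'n \<Rightarrow> real" where
  "spectral_radius X = Max (cmod ` eigenvalues (map_matrix complex_of_real X))"

text \<open>The discrete-time system \<open>x(k+1) = A x(k) + B u(k)\<close>, \<open>y(k) = C x(k)\<close>.\<close>

primrec state :: "real^'n^'n \<Rightarrow> real^'m^'n \<Rightarrow> (nat \<Rightarrow> real^'m) \<Rightarrow> real^'n \<Rightarrow> nat \<Rightarrow> real^'n" where
  "state A B u x0 0 = x0"
| "state A B u x0 (Suc k) = A *v state A B u x0 k + B *v u k"

definition controllable :: "real^'n^'n \<Rightarrow> real^'m^'n \<Rightarrow> bool" where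
  "controllable A B \<longleftrightarrow> (\<forall>x0 xf. \<exists>N u. state A B u x0 N = xf)"

text \<open>By linearity, a known input does not affect whether the outputs determine the initial state,
  so observability is stated for the unforced system.\<close>

definition observable :: "real^'n^'n \<Rightarrow> real^'n^'p \<Rightarrow> bool" where
  "observable A C \<longleftrightarrow>
    (\<exists>N. \<forall>x0 x0'. (\<forall>k<N. C *v (matpow A k *v x0) = C *v (matpow A k *v x0')) \<longrightarrow> x0 = x0')"

definition closed_loop ::
  "real^'n^'n \<Rightarrow> real^'m^'n \<Rightarrow> real^'n^'m \<Rightarrow> real^'n^'m \<Rightarrow> real^'m^'n \<Rightarrow> real^('n::finite + 'n)^('n::finite + 'n)" where
  "closed_loop A B C K L = vcat (hcat A (B ** K)) (hcat (L ** C) (A - L ** C + B ** K))"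

definition closed_loop_noise ::
  "real^'m^'n \<Rightarrow> real^'n^'n \<Rightarrow> real^'m^'m \<Rightarrow> real^('n::finite + 'n)^('n::finite + 'n)" where
  "closed_loop_noise L Sdd Snn = vcat (hcat Sdd 0) (hcat 0 (L ** Snn ** transpose L))"

definition M2_matrix ::
  "real^'m^'n \<Rightarrow> real^('n::finite + 'n)^('n::finite + 'n) \<Rightarrow> real^('n::finite + 'n)^('n::finite + 'n) \<Rightarrow> real^'m^'m" where
  "M2_matrix L \<Phi> Sxi =
    hcat (0 :: real^'n^'m) (transpose L)
    ** (\<Sum>k. matpow (transpose \<Phi>) k ** matrix_inv Sxi ** matpow \<Phi> k)
    ** vcat (0 :: real^'m^'n) L"

definition attack_cost :: "real \<Rightarrow> real^'m^'m \<Rightarrow> real^'m^'m \<Rightarrow> real^'m^'m \<Rightarrow> real" where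
  "attack_cost lam M1 M2 S =
    lam * (trace (M1 ** S) - ln (det (mat 1 + M1 ** S))) - trace (M2 ** S) + ln (det (mat 1 + M2 ** S))"

definition sensor_attack :: "real \<Rightarrow> 'm \<Rightarrow> real^'m^'m" where
  "sensor_attack v i = v *\<^sub>R ((columnvector (axis i 1) :: real^1^'m) ** rowvector (axis i 1))"

definition single_attacks :: "(real^'m^'m) set" where
  "single_attacks = {sensor_attack v i | v i. v > 0}"

definition optimal_attack :: "real \<Rightarrow> real^'m^'m \<Rightarrow> real^'m^'m \<Rightarrow> real^'m^'m \<Rightarrow> bool" where
  "optimal_attack lam M1 M2 S \<longleftrightarrow> is_arg_min (attack_cost lam M1 M2) (\<lambda>X. X \<in> single_attacks) S"

definition diag_form :: "real^'m^'m \<Rightarrow> 'm \<Rightarrow> real" where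
  "diag_form M i = axis i 1 \<bullet> (M *v axis i 1)"

definition best_variance :: "real \<Rightarrow> real^'m^'m \<Rightarrow> real^'m^'m \<Rightarrow> 'm \<Rightarrow> real" where
  "best_variance lam M1 M2 i =
    ((diag_form M2 i)\<^sup>2 - lam * (diag_form M1 i)\<^sup>2) /
    ((lam * diag_form M1 i - diag_form M2 i) * diag_form M1 i * diag_form M2 i)"

text \<open>A predicate rather than a chosen index, since several sensors can attain the minimum.\<close>

definition best_sensor :: "real \<Rightarrow> real^'m^'m \<Rightarrow> real^'m^'m \<Rightarrow> 'm \<Rightarrow> bool" where
  "best_sensor lam M1 M2 i \<longleftrightarrow>
    is_arg_min (\<lambda>j. attack_cost lam M1 M2 (sensor_attack (best_variance lam M1 M2 j) j)) (\<lambda>_. True) i"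

end

theory Submission
  imports Defs "HOL-Computational_Algebra.Fundamental_Theorem_Algebra"
begin

text \<open>
  Along sensor \<open>i\<close> the cost depends only on \<open>v\<close> and the diagonal entries \<open>a\<close>, \<open>b\<close> of
  \<open>M1\<close>, \<open>M2\<close> at \<open>i\<close>. Its derivative in \<open>v > 0\<close> has the sign of the affine function
  \<open>a b (lam a - b) v - (b\<^sup>2 - lam a\<^sup>2)\<close>, which by the bounds on \<open>lam\<close> is increasing with a
  positive root, provided that \<open>a, b > 0\<close>. The bounds exclude the value \<open>0\<close>, so it is enough that the
  quadratic forms are nonnegative: for \<open>M1\<close> this follows by iterating the Lyapunov equation,
  for \<open>M2\<close> from the terms of its series. Both need decay of the powers of \<open>\<Phi>\<close>, which is
  obtained from an annihilating polynomial by removing its roots one at a time.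
\<close>

section \<open>Powers of a matrix of spectral radius less than one\<close>

lemma matpow_Suc_right: "matpow X (Suc k) = matpow X k ** X"
  by (induction k) (simp_all add: matrix_mul_assoc)

lemma transpose_matpow: "transpose (matpow X k) = matpow (transpose X) k"
  for X :: "'a::comm_semiring_1^'n^'n"
proof (induction k)
  case (Suc k)
  then show ?case
    by (subst matpow_Suc_right) (simp add: matrix_transpose_mul)
qed (simp add: transpose_mat)

section \<open>Polynomials of a complex matrix acting on a vector\<close>

text \<open>This is \<open>p(X) x\<close>. Only the action on vectors matters below, so
  \<open>p(X)\<close> itself is never formed.\<close>

definition poly_act :: "complex^'n^'n \<Rightarrow> complex poly \<Rightarrow> complex^'n \<Rightarrow> complex^'n" where
  "poly_act X p x = (\<Sum>k\<le>degree p. coeff p k *s (matpow X k *v x))"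

lemma poly_act_upto:
  assumes "degree p \<le> N"
  shows "poly_act X p x = (\<Sum>k\<le>N. coeff p k *s (matpow X k *v x))"
  unfolding poly_act_def
  using assms by (intro sum.mono_neutral_left) (auto simp: coeff_eq_0)

lemma poly_act_pCons: "poly_act X (pCons a p) x = a *s x + X *v poly_act X p x"
proof -
  \<comment> \<open>Summing up to \<open>Suc (degree p)\<close> also covers \<open>p = 0\<close>,
    where \<open>pCons a p\<close> has degree 0.\<close>
  have "poly_act X (pCons a p) x = (\<Sum>k\<le>Suc (degree p). coeff (pCons a p) k *s (matpow X k *v x))"
    by (intro poly_act_upto) (simp add: degree_pCons_le)
  also have "\<dots> = a *s x + (\<Sum>k\<le>degree p. coeff p k *s (X *v (matpow X k *v x)))"
    by (simp only: sum.atMost_Suc_shift)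
      (simp add: matrix_vector_mul_assoc)
  also have "(\<Sum>k\<le>degree p. coeff p k *s (X *v (matpow X k *v x))) = X *v poly_act X p x"
    by (simp add: poly_act_def vector_scalar_commute vec.sum)
  finally show ?thesis .
qed

lemma poly_act_0: "poly_act X 0 x = 0"
  by (simp add: poly_act_def)

text \<open>The coefficients of \<open>(z - l) q\<close> are those of \<open>z q\<close> minus
  \<open>l\<close> times those of \<open>q\<close>. With one common upper bound for the degrees, the
  sum splits accordingly.\<close>

lemma poly_act_linear_factor:
  "poly_act X ([:-l, 1:] * q) x = X *v poly_act X q x - l *s poly_act X q x"
proof -
  have eq: "coeff ([:-l, 1:] * q) k = coeff (pCons 0 q) k - l * coeff q k" for k
    by simp
  let ?N = "Suc (degree q)"
  have "degree ([:-l, 1:] * q) \<le> ?N"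
    by (rule order_trans[OF degree_mult_le]) simp
  then have "poly_act X ([:-l, 1:] * q) x =
      (\<Sum>k\<le>?N. (coeff (pCons 0 q) k - l * coeff q k) *s (matpow X k *v x))"
    by (simp only: poly_act_upto eq)
  also have "\<dots> = (\<Sum>k\<le>?N. coeff (pCons 0 q) k *s (matpow X k *v x)) -
      l *s (\<Sum>k\<le>?N. coeff q k *s (matpow X k *v x))"
    by (simp only: vec.scale_left_diff_distrib sum_subtractf vec.scale_sum_right vec.scale_scale)
  also have "\<dots> = poly_act X (pCons 0 q) x - l *s poly_act X q x"
    by (simp only: poly_act_upto[symmetric, of _ ?N] degree_pCons_le order.refl le_SucI)
  finally show ?thesis
    by (simp add: poly_act_pCons)
qed

text \<open>A Horner step applies \<open>X\<close> and adds a multiple of \<open>x\<close>, and both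
  operations commute with \<open>X - l\<close>.\<close>

lemma poly_act_commute:
  "X *v poly_act X q x - l *s poly_act X q x = poly_act X q (X *v x - l *s x)"
proof (induction q)
  case 0
  then show ?case by (simp add: poly_act_0)
next
  case (pCons a q)
  show ?case
    unfolding poly_act_pCons pCons.IH[symmetric]
    by (simp add: vec.add vec.diff vec.scale algebra_simps vec.scale_right_distrib
        vec.scale_right_diff_distrib vec.scale_left_commute)
qed

lemma poly_act_eigenvector:
  assumes "X *v x = l *s x"
  shows "poly_act X p x = poly p l *s x"
proof (induction p)
  case (pCons a p)
  have "poly_act X (pCons a p) x = a *s x + X *v (poly p l *s x)"
    by (simp only: poly_act_pCons pCons.IH)
  also have "\<dots> = poly (pCons a p) l *s x"
    by (simp only: vec.scale assms) (simp add: vec_eq_iff algebra_simps)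
  finally show ?case .
qed (simp add: poly_act_0)

text \<open>In a space of real dimension \<open>d\<close>, the \<open>d + 1\<close> powers from 0 to
  \<open>d\<close> satisfy a nontrivial linear relation; its coefficients form the
  polynomial.\<close>

lemma exists_annihilating_poly:
  fixes X :: "complex^'n^'n"
  obtains p where "p \<noteq> 0" and "\<And>x. poly_act X p x = 0"
proof -
  let ?d = "DIM(complex^'n^'n)"
  obtain c where c: "(\<Sum>k\<le>?d. c k *\<^sub>R matpow X k) = 0" "\<exists>k\<le>?d. c k \<noteq> (0::real)"
  \<comment> \<open>\<open>dependent\<close> speaks of sets, so coinciding powers need their own
    case; there the relation is the difference of two equal powers.\<close>
  proof (cases "inj_on (matpow X) {..?d}")
    case True
    then have "card (matpow X ` {..?d}) > ?d"
      by (simp add: card_image)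
    then have "dependent (matpow X ` {..?d})"
      by (intro dependent_biggerset) auto
    then obtain u where u: "\<exists>v\<in>matpow X ` {..?d}. u v \<noteq> 0"
      "(\<Sum>v\<in>matpow X ` {..?d}. u v *\<^sub>R v) = 0"
      by (subst (asm) dependent_finite) auto
    show ?thesis
    proof (rule that[of "\<lambda>k. u (matpow X k)"])
      show "(\<Sum>k\<le>?d. u (matpow X k) *\<^sub>R matpow X k) = 0"
        using u(2) by (subst (asm) sum.reindex[OF True]) simp
    qed (use u(1) in auto)
  next
    case False
    then obtain i j where ij: "i \<le> ?d" "j \<le> ?d" "i \<noteq> j" "matpow X i = matpow X j"
      by (auto simp: inj_on_def)
    show ?thesis
    proof (rule that[of "\<lambda>k. (if k = i then 1 else 0) - (if k = j then 1 else 0)"])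
      show "(\<Sum>k\<le>?d. ((if k = i then 1 else 0) - (if k = j then 1 else 0)) *\<^sub>R matpow X k) = 0"
        using ij by (simp add: scaleR_left_diff_distrib sum_subtractf
            if_distrib[of "\<lambda>r. r *\<^sub>R _"] cong: if_cong)
    qed (use ij in auto)
  qed
  define p where "p = Poly (map (\<lambda>k. complex_of_real (c k)) [0..<Suc ?d])"
  have coeff: "coeff p k = (if k \<le> ?d then complex_of_real (c k) else 0)" for k
    by (simp add: p_def nth_default_def less_Suc_eq_le del: upt_Suc)
  show ?thesis
  proof (rule that[of p])
    show "p \<noteq> 0"
      using c(2) coeff by (metis coeff_0 of_real_eq_0_iff)
    fix x
    have "degree p \<le> ?d"
      by (rule degree_le) (simp add: coeff)
    then have "poly_act X p x = (\<Sum>k\<le>?d. complex_of_real (c k) *s (matpow X k *v x))"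
      by (subst poly_act_upto, assumption) (rule sum.cong, simp_all add: coeff)
    also have "\<dots> = (\<Sum>k\<le>?d. (c k *\<^sub>R matpow X k) *v x)"
      by (intro sum.cong refl)
        (simp add: vec_eq_iff matrix_vector_mult_def sum_distrib_left
          scaleR_conv_of_real[where 'a = complex] mult.assoc)
    also have "\<dots> = (\<Sum>k\<le>?d. c k *\<^sub>R matpow X k) *v x"
      by (induction rule: finite_induct[OF finite_atMost])
        (simp_all add: matrix_vector_mult_add_rdistrib)
    finally show "poly_act X p x = 0"
      by (simp only: c(1) matrix_vector_mult_0)
  qed
qed

text \<open>Every eigenvalue is a root of an annihilating polynomial. Finiteness is what lets
  \<open>Max\<close> in \<open>spectral_radius\<close> bound all eigenvalues.\<close>

lemma finite_eigenvalues: "finite (eigenvalues X)"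
proof -
  obtain p where p: "p \<noteq> 0" "\<And>x. poly_act X p x = 0"
    using exists_annihilating_poly by blast
  have "eigenvalues X \<subseteq> {l. poly p l = 0}"
    using p(2) by (auto simp: eigenvalues_def dest!: poly_act_eigenvector[where p = p])
  with p(1) show ?thesis
    using finite_subset poly_roots_finite by blast
qed

lemma norm_eigenvalue_le_spectral_radius:
  "l \<in> eigenvalues (map_matrix complex_of_real X) \<Longrightarrow> cmod l \<le> spectral_radius X"
  unfolding spectral_radius_def by (intro Max_ge) (auto simp: finite_eigenvalues)

section \<open>Summability of orbits and decay of powers\<close>

lemma norm_vec_scale: "norm (l *s x) = cmod l * norm x" for x :: "complex^'n"
  by (simp add: norm_vec_def L2_set_right_distrib norm_mult)

text \<open>A partial sum \<open>S\<close> of the norms of \<open>u\<close> satisfies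
  \<open>S \<le> norm (u 0) + cmod l * S + W\<close>, with \<open>W\<close> the total of the norms
  of \<open>w\<close>. Since \<open>cmod l < 1\<close>, this bounds \<open>S\<close>
  uniformly.\<close>

lemma summable_norm_recurrence:
  fixes u w :: "nat \<Rightarrow> complex^'n"
  assumes rec: "\<And>k. u (Suc k) = l *s u k + w k"
    and l: "cmod l < 1" and w: "summable (\<lambda>k. norm (w k))"
  shows "summable (\<lambda>k. norm (u k))"
proof (rule summableI_nonneg_bounded)
  fix n
  let ?S = "\<Sum>k<n. norm (u k)" and ?W = "\<Sum>k. norm (w k)"
  have "?S \<le> (\<Sum>k<Suc n. norm (u k))"
    by simp
  also have "\<dots> = norm (u 0) + (\<Sum>k<n. norm (u (Suc k)))"
    by (simp only: sum.lessThan_Suc_shift)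
  also have "(\<Sum>k<n. norm (u (Suc k))) \<le> (\<Sum>k<n. cmod l * norm (u k) + norm (w k))"
    by (intro sum_mono) (metis rec norm_triangle_ineq norm_vec_scale)
  also have "\<dots> \<le> cmod l * ?S + ?W"
    using sum_le_suminf[OF w, of "{..<n}"] by (simp add: sum.distrib sum_distrib_left)
  finally have "?S * (1 - cmod l) \<le> norm (u 0) + ?W"
    by (simp add: algebra_simps)
  then show "?S \<le> (norm (u 0) + ?W) / (1 - cmod l)"
    using l by (simp add: field_simps)
qed simp

text \<open>
  Induction on the degree of an annihilating polynomial. A root \<open>l\<close> inside the unit disc is removed
  by passing from \<open>x\<close> to \<open>X x - l x\<close>; any other root is not an eigenvalue, so that its factor
  is injective and can be cancelled.
\<close>

lemma summable_matpow_of_annihilating_poly: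
  fixes X :: "complex^'n^'n"
  assumes ev: "\<And>l. l \<in> eigenvalues X \<Longrightarrow> cmod l < 1"
    and "p \<noteq> 0" "poly_act X p x = 0"
  shows "summable (\<lambda>k. norm (matpow X k *v x))"
  using assms(2,3)
proof (induction "degree p" arbitrary: p x)
  case 0
  then obtain a where "p = [:a:]"
    using degree_0_id by metis
  with 0 have "x = 0"
    by (simp add: poly_act_pCons poly_act_0)
  then show ?case by simp
next
  case (Suc d)
  have "\<not> constant (poly p)"
    using Suc.hyps(2) by (simp add: constant_degree)
  then obtain l where "poly p l = 0"
    using fundamental_theorem_of_algebra by blast
  then obtain q where q: "p = [:-l, 1:] * q"
    unfolding poly_eq_0_iff_dvd by (rule dvdE)
  then have "q \<noteq> 0"
    using Suc.prems(1) by auto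
  moreover have "degree p = Suc (degree q)"
    unfolding q using \<open>q \<noteq> 0\<close> by (subst degree_mult_eq) auto
  ultimately have IH: "summable (\<lambda>k. norm (matpow X k *v y))" if "poly_act X q y = 0" for y
    using Suc.hyps that by simp
  have 0: "X *v poly_act X q x - l *s poly_act X q x = 0"
    using Suc.prems(2) by (simp only: q poly_act_linear_factor)
  show ?case
  proof (cases "cmod l < 1")
    case True
    have "summable (\<lambda>k. norm (matpow X k *v (X *v x - l *s x)))"
      using 0 by (intro IH) (simp add: poly_act_commute)
    \<comment> \<open>The orbit of \<open>x\<close> obeys a first-order recurrence forced by the
      orbit of \<open>X x - l x\<close>, which is summable by induction.\<close>
    moreover have "matpow X (Suc k) *v x = l *s (matpow X k *v x) + matpow X k *v (X *v x - l *s x)" for k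
      by (simp add: matpow_Suc_right vec.diff vec.scale matrix_vector_mul_assoc del: matpow.simps(2))
    ultimately show ?thesis
      by (rule summable_norm_recurrence[of "\<lambda>k. matpow X k *v x", OF _ True, rotated])
  next
    case False
    then have "l \<notin> eigenvalues X"
      using ev by blast
    with 0 have "poly_act X q x = 0"
      by (auto simp: eigenvalues_def)
    then show ?thesis
      by (rule IH)
  qed
qed

text \<open>Embedding real vectors entrywise into complex ones preserves norms and intertwines
  \<open>X\<close> with its complexification, so the complex result transfers.\<close>

lemma summable_norm_matpow_vector:
  fixes X :: "real^'n^'n"
  assumes "spectral_radius X < 1"
  shows "summable (\<lambda>k. norm (matpow X k *v x))"
proof -
  let ?X = "map_matrix complex_of_real X" and ?c = "\<lambda>x::real^'n. (\<chi> i. complex_of_real (x $ i))"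
  have mult: "?X *v ?c y = ?c (X *v y)" for y
    by (simp add: vec_eq_iff matrix_vector_mult_def map_matrix_def)
  have "matpow ?X k *v ?c x = ?c (matpow X k *v x)" for k
    by (induction k) (simp_all add: mult matrix_vector_mul_assoc[symmetric])
  moreover have "norm (?c y) = norm y" for y
    by (simp add: norm_vec_def)
  moreover have "summable (\<lambda>k. norm (matpow ?X k *v ?c x))"
  proof -
    obtain p where p: "p \<noteq> 0" "\<And>x. poly_act ?X p x = 0"
      using exists_annihilating_poly by blast
    have "cmod l < 1" if "l \<in> eigenvalues ?X" for l
      using norm_eigenvalue_le_spectral_radius[OF that] assms by linarith
    then show ?thesis
      using p by (rule summable_matpow_of_annihilating_poly)
  qed
  ultimately show ?thesis
    by simp
qed

lemma matpow_tendsto_0: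
  fixes X :: "real^'n^'n"
  assumes "spectral_radius X < 1"
  shows "(\<lambda>k. matpow X k) \<longlonglongrightarrow> 0"
proof (intro vec_tendstoI)
  fix i j
  have "(\<lambda>k. matpow X k *v axis j 1) \<longlonglongrightarrow> 0"
    using summable_LIMSEQ_zero[OF summable_norm_matpow_vector[OF assms]]
    by (simp add: tendsto_norm_zero_iff)
  from tendsto_vec_nth[OF this, of i] show "(\<lambda>k. matpow X k $ i $ j) \<longlonglongrightarrow> 0 $ i $ j"
    by (simp add: matrix_vector_mult_basis column_def)
qed

section \<open>Matrix entries as bilinear forms, and the Gramian series\<close>

lemma inner_matrix_mult_axis: "axis i 1 \<bullet> (M *v axis j 1) = M $ i $ j" for M :: "real^'n^'m"
  by (simp add: matrix_vector_mult_basis column_def inner_axis')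

lemma diag_form_eq: "diag_form M i = M $ i $ i"
  by (simp add: diag_form_def inner_matrix_mult_axis)

lemma inner_matrix_congruence:
  "x \<bullet> ((transpose P ** W ** P) *v y) = (P *v x) \<bullet> (W *v (P *v y))" for P :: "real^'n^'m"
  by (simp add: matrix_vector_mul_assoc[symmetric] dot_lmul_matrix[symmetric]
      flip: transpose_matrix_vector)

text \<open>Entry \<open>(i, j)\<close> of the \<open>k\<close>-th term pairs \<open>X^k e_i\<close>
  with \<open>W X^k e_j\<close>, so Cauchy-Schwarz reduces its convergence to summability of the
  orbits.\<close>

lemma summable_gramian:
  fixes X W :: "real^'n^'n"
  assumes "spectral_radius X < 1"
  shows "summable (\<lambda>k. matpow (transpose X) k ** W ** matpow X k)"
proof -
  let ?P = "\<lambda>k. matpow X k"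
  let ?G = "\<lambda>k. transpose (?P k) ** W ** ?P k"
  have entry: "summable (\<lambda>k. \<bar>?G k $ i $ j\<bar>)" for i j
  proof (rule summable_comparison_test_ev)
    let ?u = "\<lambda>i k. norm (?P k *v axis i 1)"
    have "(\<lambda>k. ?u i k) \<longlonglongrightarrow> 0"
      using summable_LIMSEQ_zero[OF summable_norm_matpow_vector[OF assms]] .
    \<comment> \<open>Bounding one orbit by 1 eventually leaves a constant times the other orbit as
      a summable majorant.\<close>
    then have "\<forall>\<^sub>F k in sequentially. ?u i k < 1"
      by (simp add: order_tendstoD)
    then show "\<forall>\<^sub>F k in sequentially. norm \<bar>?G k $ i $ j\<bar> \<le> onorm ((*v) W) * ?u j k"
    proof eventually_elim
      case (elim k)
      have "\<bar>?G k $ i $ j\<bar> = \<bar>(?P k *v axis i 1) \<bullet> (W *v (?P k *v axis j 1))\<bar>"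
        by (simp only: inner_matrix_congruence[symmetric] inner_matrix_mult_axis)
      also have "\<dots> \<le> ?u i k * norm (W *v (?P k *v axis j 1))"
        by (rule Cauchy_Schwarz_ineq2)
      also have "\<dots> \<le> 1 * (onorm ((*v) W) * ?u j k)"
        using elim by (intro mult_mono onorm) auto
      finally show ?case by simp
    qed
    show "summable (\<lambda>k. onorm ((*v) W) * ?u j k)"
      by (intro summable_mult summable_norm_matpow_vector assms)
  qed
  have "norm (?G k) \<le> (\<Sum>i\<in>UNIV. \<Sum>j\<in>UNIV. \<bar>?G k $ i $ j\<bar>)" for k
  proof -
    have "norm (?G k) \<le> (\<Sum>i\<in>UNIV. norm (?G k $ i))"
      unfolding norm_vec_def[of "?G k"] by (rule L2_set_le_sum) simp
    also have "\<dots> \<le> (\<Sum>i\<in>UNIV. \<Sum>j\<in>UNIV. \<bar>?G k $ i $ j\<bar>)"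
      by (intro sum_mono norm_le_l1_cart)
    finally show ?thesis .
  qed
  then have "summable ?G"
    by (intro summable_comparison_test'[OF summable_sum[OF summable_sum[OF entry]]])
  then show ?thesis
    by (simp add: transpose_matpow)
qed

section \<open>Nonnegativity of the two weights\<close>

lemma sum_UNIV_Plus: "sum f UNIV = (\<Sum>i\<in>UNIV. f (Inl i)) + (\<Sum>i\<in>UNIV. f (Inr i))"
  for f :: "'a::finite + 'b::finite \<Rightarrow> 'c::comm_monoid_add"
  by (simp add: UNIV_Plus_UNIV[symmetric] sum.Plus del: UNIV_Plus_UNIV)

text \<open>The equation makes the form of \<open>S\<close> nonincreasing along the orbit of
  \<open>x\<close> under \<open>transpose X\<close>. The orbit tends to 0, so the initial value is
  at least the limit 0.\<close>

lemma lyapunov_solution_nonneg: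
  fixes X S Q :: "real^'n^'n"
  assumes "spectral_radius X < 1" and S: "S = X ** S ** transpose X + Q"
    and Q: "\<And>x. 0 \<le> x \<bullet> (Q *v x)"
  shows "0 \<le> x \<bullet> (S *v x)"
proof -
  let ?y = "\<lambda>k. matpow (transpose X) k *v x"
  have step: "(transpose X *v y) \<bullet> (S *v (transpose X *v y)) \<le> y \<bullet> (S *v y)" for y
  proof -
    have "y \<bullet> (S *v y) = y \<bullet> ((X ** S ** transpose X) *v y) + y \<bullet> (Q *v y)"
      by (subst S) (simp add: matrix_vector_mult_add_rdistrib inner_add_right)
    then show ?thesis
      using Q[of y] inner_matrix_congruence[of y "transpose X" S y] by simp
  qed
  have le: "?y k \<bullet> (S *v ?y k) \<le> x \<bullet> (S *v x)" for k
  proof (induction k)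
    case (Suc k)
    then show ?case
      using step[of "?y k"] by (simp add: matrix_vector_mul_assoc)
  qed simp
  have entry: "(\<lambda>k. matpow X k $ j $ i) \<longlonglongrightarrow> 0" for i j
    using tendsto_vec_nth[OF tendsto_vec_nth[OF matpow_tendsto_0[OF assms(1)]]] by simp
  have "(\<lambda>k. ?y k $ i) \<longlonglongrightarrow> 0 $ i" for i
  proof -
    \<comment> \<open>Transposing the powers reduces decay under \<open>transpose X\<close> to the
      known decay of the entries of \<open>matpow X k\<close>.\<close>
    have "?y k $ i = (\<Sum>j\<in>UNIV. matpow X k $ j $ i * x $ j)" for k
      by (simp only: transpose_matpow[symmetric]) (simp add: matrix_vector_mult_def transpose_def
          del: transpose_matrix_vector)
    then show ?thesis
      by (simp only: zero_index) (intro tendsto_null_sum tendsto_mult_left_zero entry)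
  qed
  then have "?y \<longlonglongrightarrow> 0"
    by (rule vec_tendstoI)
  moreover from this have "(\<lambda>k. S *v ?y k) \<longlonglongrightarrow> S *v 0"
    by (rule bounded_linear.tendsto[OF matrix_vector_mul_bounded_linear])
  ultimately have "(\<lambda>k. ?y k \<bullet> (S *v ?y k)) \<longlonglongrightarrow> 0 \<bullet> (S *v 0)"
    by (rule tendsto_inner)
  then show ?thesis
    using le by (intro LIMSEQ_le_const2[of _ 0]) auto
qed

text \<open>With \<open>y = matrix_inv S *v x\<close>, the form of the inverse at \<open>x\<close>
  equals the form of \<open>S\<close> at \<open>y\<close>.\<close>

lemma matrix_inv_form_nonneg:
  fixes S :: "real^'n^'n"
  assumes "invertible S" and "\<And>x. 0 \<le> x \<bullet> (S *v x)"
  shows "0 \<le> x \<bullet> (matrix_inv S *v x)"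
proof -
  have "S ** matrix_inv S = mat 1"
    using assms(1) unfolding invertible_def matrix_inv_def by (rule someI2_ex) simp
  then have "S *v (matrix_inv S *v x) = x"
    by (simp add: matrix_vector_mul_assoc)
  then show ?thesis
    using assms(2)[of "matrix_inv S *v x"] by (simp add: inner_commute)
qed

lemma closed_loop_noise_form_nonneg:
  assumes "psd_matrix Sdd" "psd_matrix Snn"
  shows "0 \<le> x \<bullet> (closed_loop_noise L Sdd Snn *v x)"
proof -
  let ?x1 = "\<chi> i. x $ Inl i" and ?x2 = "\<chi> i. x $ Inr i"
  have "x \<bullet> (closed_loop_noise L Sdd Snn *v x) =
      ?x1 \<bullet> (Sdd *v ?x1) + ?x2 \<bullet> ((L ** Snn ** transpose L) *v ?x2)"
    by (simp add: inner_vec_def sum_UNIV_Plus closed_loop_noise_def vcat_def hcat_def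
        matrix_vector_mult_def)
  then show ?thesis
    using assms inner_matrix_congruence[of ?x2 "transpose L" Snn ?x2]
    by (simp add: psd_matrix_def)
qed

text \<open>The form of the block at \<open>x\<close> is the form of \<open>S\<close> at
  \<open>x\<close> padded with zeros.\<close>

lemma upper_left_block_form_nonneg:
  fixes S :: "real^('n::finite + 'm::finite)^('n + 'm)"
  assumes "\<And>x. 0 \<le> x \<bullet> (S *v x)"
  shows "0 \<le> x \<bullet> (upper_left_block S *v x)"
proof -
  let ?z = "(\<chi> i. case i of Inl k \<Rightarrow> x $ k | Inr k \<Rightarrow> 0) :: real^('n + 'm)"
  have "x \<bullet> (upper_left_block S *v x) = ?z \<bullet> (S *v ?z)"
    by (simp add: inner_vec_def sum_UNIV_Plus upper_left_block_def matrix_vector_mult_def)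
  then show ?thesis
    using assms by simp
qed

lemma diag_form_M2_nonneg:
  assumes "spectral_radius \<Phi> < 1" and "\<And>x. 0 \<le> x \<bullet> (matrix_inv S *v x)"
  shows "0 \<le> diag_form (M2_matrix L \<Phi> S) i"
proof -
  let ?V = "vcat (0 :: real^'b^'a) L"
  let ?G = "\<lambda>k. matpow (transpose \<Phi>) k ** matrix_inv S ** matpow \<Phi> k"
  let ?w = "?V *v axis i 1"
  \<comment> \<open>The form at a fixed vector is linear in the matrix, hence passes through the
    infinite series term by term.\<close>
  have lin: "bounded_linear (\<lambda>G. ?w \<bullet> (G *v ?w))"
    by (intro linear_conv_bounded_linear[THEN iffD1] linearI)
      (simp_all add: matrix_vector_mult_add_rdistrib inner_add_right scaleR_matrix_vector_assoc[symmetric])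
  have "hcat (0 :: real^'a^'b) (transpose L) = transpose ?V"
    by (simp add: vec_eq_iff hcat_def vcat_def transpose_def split: sum.split)
  then have "diag_form (M2_matrix L \<Phi> S) i = ?w \<bullet> (suminf ?G *v ?w)"
    by (simp only: diag_form_def M2_matrix_def inner_matrix_congruence)
  also have "\<dots> = (\<Sum>k. ?w \<bullet> (?G k *v ?w))"
    using bounded_linear.suminf[OF lin summable_gramian[OF assms(1)]] .
  also have "\<dots> \<ge> 0"
    using bounded_linear.summable[OF lin summable_gramian[OF assms(1)]]
    by (rule suminf_nonneg)
      (simp only: transpose_matpow[symmetric] inner_matrix_congruence assms(2))
  finally show ?thesis .
qed

section \<open>The attack cost along one sensor\<close>

definition scalar_cost :: "real \<Rightarrow> real \<Rightarrow> real \<Rightarrow> real \<Rightarrow> real" where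
  "scalar_cost lam a b v = lam * (a * v - ln (1 + a * v)) - b * v + ln (1 + b * v)"

lemma sensor_attack_component: "sensor_attack v i $ r $ c = (if r = i \<and> c = i then v else 0)"
  by (simp add: sensor_attack_def matrix_matrix_mult_def columnvector_def rowvector_def axis_def)

lemma mult_sensor_attack:
  "(M ** sensor_attack v i) $ r $ c = (if c = i then v * M $ r $ i else 0)"
  by (simp add: matrix_matrix_mult_def sensor_attack_component if_distrib[of "(*) _"] cong: if_cong)

lemma trace_mult_sensor_attack: "trace (M ** sensor_attack v i) = M $ i $ i * v"
  by (simp add: trace_def mult_sensor_attack)

text \<open>The matrix is the identity with column \<open>i\<close> replaced, so Cramer's rule for
  the identity reads off the determinant as entry \<open>i\<close> of the new column.\<close>

lemma det_one_plus_mult_sensor_attack: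
  "det (mat 1 + M ** sensor_attack v i) = 1 + M $ i $ i * v"
proof -
  let ?x = "axis i 1 + v *\<^sub>R column i M"
  have "mat 1 + M ** sensor_attack v i =
      (\<chi> r c. if c = i then (mat 1 *v ?x) $ r else (mat 1 :: real^'a^'a) $ r $ c)"
    by (simp only: matrix_vector_mul_lid)
      (simp add: vec_eq_iff mult_sensor_attack mat_def axis_def column_def)
  then show ?thesis
    by (simp only: cramer_lemma) (simp add: column_def mult.commute)
qed

lemma attack_cost_sensor_attack:
  "attack_cost lam M1 M2 (sensor_attack v i) = scalar_cost lam (diag_form M1 i) (diag_form M2 i) v"
  by (simp add: attack_cost_def scalar_cost_def trace_mult_sensor_attack
      det_one_plus_mult_sensor_attack diag_form_eq)

text \<open>The factor \<open>v\<close> comes from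
  \<open>a - a / (1 + a * v) = a\<^sup>2 * v / (1 + a * v)\<close> and its analogue for
  \<open>b\<close>. In this form the sign is that of the affine factor.\<close>

lemma scalar_cost_deriv:
  assumes "a > 0" "b > 0" "v > 0"
  shows "(scalar_cost lam a b has_real_derivative
    v * (a * b * (lam * a - b) * v - (b\<^sup>2 - lam * a\<^sup>2)) / ((1 + a * v) * (1 + b * v))) (at v)"
proof -
  have pos: "1 + a * v > 0" "1 + b * v > 0"
    using assms by (simp_all add: add_pos_pos)
  have "(scalar_cost lam a b has_real_derivative
      lam * (a - a / (1 + a * v)) - b + b / (1 + b * v)) (at v)"
    unfolding scalar_cost_def[abs_def] using pos
    by (auto intro!: derivative_eq_intros)
  moreover have "lam * (a - a / (1 + a * v)) - b + b / (1 + b * v) =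
      v * (a * b * (lam * a - b) * v - (b\<^sup>2 - lam * a\<^sup>2)) / ((1 + a * v) * (1 + b * v))"
    using pos by (simp add: field_simps power2_eq_square)
  ultimately show ?thesis
    by simp
qed

lemma scalar_cost_minimum:
  assumes a: "a > 0" and b: "b > 0" and c: "lam * a - b > 0"
    and s: "s = (b\<^sup>2 - lam * a\<^sup>2) / ((lam * a - b) * a * b)" "s > 0"
    and v: "v > 0" "v \<noteq> s"
  shows "scalar_cost lam a b s < scalar_cost lam a b v"
proof -
  \<comment> \<open>This is the slope of the affine factor; since \<open>s\<close> is its root, the
    factor becomes \<open>k * (x - s)\<close>.\<close>
  define k where "k = a * b * (lam * a - b)"
  have k: "k > 0"
    using a b c by (simp add: k_def)
  have "b\<^sup>2 - lam * a\<^sup>2 = k * s"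
    using a b c by (simp add: s(1) k_def mult.commute mult.left_commute)
  then have deriv: "(scalar_cost lam a b has_real_derivative
      x * (k * (x - s)) / ((1 + a * x) * (1 + b * x))) (at x)" if "x > 0" for x
    using scalar_cost_deriv[OF a b that, of lam]
    by (simp only: k_def[symmetric]) (simp only: right_diff_distrib)
  have den: "(1 + a * x) * (1 + b * x) > 0" if "x > 0" for x
    using that a b by (simp add: add_pos_pos)
  have cont: "continuous_on {x..y} (scalar_cost lam a b)" if "x > 0" for x y
    using that by (intro continuous_at_imp_continuous_on ballI DERIV_isCont[OF deriv]) simp
  show ?thesis
  proof (cases "v < s")
    case True
    then show ?thesis
    \<comment> \<open>The derivative vanishes at \<open>s\<close>, so its strict sign is used on the
      open interval only, with continuity up to the endpoints.\<close>
    proof (rule DERIV_neg_imp_decreasing_open)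
      fix x assume x: "v < x" "x < s"
      then have "x * (k * (x - s)) < 0"
        using v(1) k by (simp add: mult_pos_neg)
      then show "\<exists>y. DERIV (scalar_cost lam a b) x :> y \<and> y < 0"
        using deriv[of x] den[of x] x v(1) by (force intro: divide_neg_pos)
    qed (use cont v in auto)
  next
    case False
    then have "s < v"
      using v(2) by simp
    then show ?thesis
    proof (rule DERIV_pos_imp_increasing_open)
      fix x assume x: "s < x" "x < v"
      then have "x * (k * (x - s)) > 0"
        using s(2) k by simp
      then show "\<exists>y. DERIV (scalar_cost lam a b) x :> y \<and> y > 0"
        using deriv[of x] den[of x] x s(2) by (force intro: divide_pos_pos)
    qed (use cont s in auto)
  qed
qed

lemma best_variance_minimises:
  assumes "diag_form M1 i \<ge> 0" "diag_form M2 i \<ge> 0" and "lam > 0"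
    and l1: "diag_form M2 i / diag_form M1 i < lam"
    and l2: "lam < (diag_form M2 i)\<^sup>2 / (diag_form M1 i)\<^sup>2"
  shows "best_variance lam M1 M2 i > 0"
    and "\<lbrakk>v > 0; v \<noteq> best_variance lam M1 M2 i\<rbrakk> \<Longrightarrow>
      attack_cost lam M1 M2 (sensor_attack (best_variance lam M1 M2 i) i)
        < attack_cost lam M1 M2 (sensor_attack v i)"
proof -
  define a b where "a = diag_form M1 i" and "b = diag_form M2 i"
  note ab = a_def[symmetric] b_def[symmetric]
  \<comment> \<open>Division by zero yields 0, so a positive quotient rules out \<open>a = 0\<close>
    as well as \<open>b = 0\<close>.\<close>
  have "b\<^sup>2 / a\<^sup>2 > 0"
    using assms(3) l2 by (simp add: ab)
  then have "a \<noteq> 0" "b \<noteq> 0"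
    by auto
  then have pos: "a > 0" "b > 0"
    using assms(1,2) by (simp_all add: ab)
  then have c: "lam * a - b > 0" "b\<^sup>2 - lam * a\<^sup>2 > 0"
    using l1 l2 by (simp_all add: ab field_simps)
  show s: "best_variance lam M1 M2 i > 0"
    using pos c by (simp add: best_variance_def ab)
  show "attack_cost lam M1 M2 (sensor_attack (best_variance lam M1 M2 i) i)
        < attack_cost lam M1 M2 (sensor_attack v i)"
    if "v > 0" "v \<noteq> best_variance lam M1 M2 i"
    unfolding attack_cost_sensor_attack ab
    by (rule scalar_cost_minimum[OF pos c(1) _ s that]) (simp add: best_variance_def ab)
qed

text \<open>Minimisation in two stages: first the variance at each fixed sensor, then the
  sensor.\<close>

lemma optimal_attack_iff:
  assumes pos: "\<And>i. best_variance lam M1 M2 i > 0"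
    and less: "\<And>v i. \<lbrakk>v > 0; v \<noteq> best_variance lam M1 M2 i\<rbrakk> \<Longrightarrow>
      attack_cost lam M1 M2 (sensor_attack (best_variance lam M1 M2 i) i)
        < attack_cost lam M1 M2 (sensor_attack v i)"
  shows "optimal_attack lam M1 M2 S \<longleftrightarrow>
    (\<exists>i. best_sensor lam M1 M2 i \<and> S = sensor_attack (best_variance lam M1 M2 i) i)"
proof
  let ?f = "attack_cost lam M1 M2" and ?v = "best_variance lam M1 M2"
  have mem: "sensor_attack (?v j) j \<in> single_attacks" for j
    using pos by (auto simp: single_attacks_def)
  {
    assume "optimal_attack lam M1 M2 S"
    then have S: "S \<in> single_attacks" and min: "\<And>T. T \<in> single_attacks \<Longrightarrow> \<not> ?f T < ?f S"
      by (auto simp: optimal_attack_def is_arg_min_def)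
    obtain v i where vi: "S = sensor_attack v i" "v > 0"
      using S by (auto simp: single_attacks_def)
    \<comment> \<open>Any other variance would be strictly improved by \<open>?v i\<close> at the
      same sensor.\<close>
    have "v = ?v i"
      using min[OF mem[of i]] less[OF vi(2), of i] vi(1) by blast
    moreover from this have "best_sensor lam M1 M2 i"
      using min[OF mem] vi(1) by (simp add: best_sensor_def is_arg_min_def)
    ultimately show "\<exists>i. best_sensor lam M1 M2 i \<and> S = sensor_attack (?v i) i"
      using vi(1) by blast
  next
    assume "\<exists>i. best_sensor lam M1 M2 i \<and> S = sensor_attack (?v i) i"
    then obtain i where i: "\<And>j. ?f S \<le> ?f (sensor_attack (?v j) j)" "S = sensor_attack (?v i) i"
      by (auto simp: best_sensor_def is_arg_min_def not_less)
    have "?f S \<le> ?f (sensor_attack v j)" if "v > 0" for v j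
      using i(1)[of j] less[OF that, of j] by fastforce
    then show "optimal_attack lam M1 M2 S"
      using i(2) mem by (auto simp: optimal_attack_def is_arg_min_def single_attacks_def not_less)
  }
qed

theorem theorem2:
  fixes A :: "real^'n^'n" and B :: "real^'m^'n" and C :: "real^'n^'m"
    and L :: "real^'m^'n" and K :: "real^'n^'m"
    and Sdd :: "real^'n^'n" and Snn :: "real^'m^'m"
    and \<Phi> Sxi :: "real^('n::finite + 'n)^('n + 'n)"
    and Sxx :: "real^'n^'n" and Syy M1 M2 :: "real^'m^'m"
    and lam :: real
  assumes "controllable A B" and "observable A C"
    and "psd_matrix Sdd" and "psd_matrix Snn"
    and "\<Phi> = closed_loop A B C K L"
    and "spectral_radius \<Phi> < 1"
    and "Sxi = \<Phi> ** Sxi ** transpose \<Phi> + closed_loop_noise L Sdd Snn"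
    and "Sxx = upper_left_block Sxi"
    and "Syy = C ** Sxx ** transpose C + Snn"
    and "invertible Sxi" and "invertible Syy"
    and "M1 = matrix_inv Syy"
    and "M2 = M2_matrix L \<Phi> Sxi"
    and "lam > 0"
    and "\<And>i. diag_form M2 i / diag_form M1 i < lam"
    and "\<And>i. lam < (diag_form M2 i)\<^sup>2 / (diag_form M1 i)\<^sup>2"
  shows "(\<exists>S. optimal_attack lam M1 M2 S)
    \<and> (\<forall>S. optimal_attack lam M1 M2 S \<longleftrightarrow>
          (\<exists>i. best_sensor lam M1 M2 i \<and> S = sensor_attack (best_variance lam M1 M2 i) i))
    \<and> ((\<exists>!i. best_sensor lam M1 M2 i) \<longrightarrow> (\<exists>!S. optimal_attack lam M1 M2 S))"
proof -
  have Sxi: "0 \<le> x \<bullet> (Sxi *v x)" for x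
    using assms(6,7) closed_loop_noise_form_nonneg[OF assms(3,4)] by (rule lyapunov_solution_nonneg)
  have "0 \<le> x \<bullet> (Syy *v x)" for x
  proof -
    \<comment> \<open>The output covariance inherits nonnegativity from the state block, evaluated
      at \<open>transpose C *v x\<close>, and from the measurement noise.\<close>
    have "x \<bullet> (Syy *v x) =
        (transpose C *v x) \<bullet> (Sxx *v (transpose C *v x)) + x \<bullet> (Snn *v x)"
      using inner_matrix_congruence[of x "transpose C" Sxx x]
      by (simp add: assms(9) matrix_vector_mult_add_rdistrib inner_add_right)
    then show ?thesis
      using upper_left_block_form_nonneg[OF Sxi] assms(4) by (simp add: assms(8) psd_matrix_def)
  qed
  then have M1: "diag_form M1 i \<ge> 0" for i
    by (simp add: assms(12) diag_form_def matrix_inv_form_nonneg assms(11))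
  have M2: "diag_form M2 i \<ge> 0" for i
    unfolding assms(13) using assms(6) matrix_inv_form_nonneg[OF assms(10) Sxi]
    by (rule diag_form_M2_nonneg)
  note min = best_variance_minimises[OF M1 M2 assms(14,15,16)]
  have iff: "optimal_attack lam M1 M2 S \<longleftrightarrow>
      (\<exists>i. best_sensor lam M1 M2 i \<and> S = sensor_attack (best_variance lam M1 M2 i) i)" for S
    using min by (rule optimal_attack_iff)
  \<comment> \<open>There are finitely many sensors, so the second stage attains its
    minimum.\<close>
  have "\<exists>i. best_sensor lam M1 M2 i"
    unfolding best_sensor_def using ex_is_arg_min_if_finite[of "UNIV :: 'm set"] by simp
  then show ?thesis
    unfolding iff by blast
qed

end
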